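(* Let $\{P_n(x)\}_{n\ge 1}$ and the coefficients $a_i(n)$ be as defined in the context. For $n\ge1$, $a_0(n)=n$ if $n$ is odd and $a_0(n)=\frac n2$ if $n$ is even; and $a_1(n)=\frac1{24}n(n-1)(7n-5)$ if $n$ is odd and $a_1(n)=\frac1{48}n(n-2)(7n-4)$ if $n$ is even. More generally, for each fixed integer $i\ge0$ there are polynomials $U_i$ and $V_i$ in $n$, each of degree $2i+1$, such that $a_i(n)=U_i(n)$ for all odd $n\ge1$ and $a_i(n)=V_i(n)$ for all even $n\ge2$.
   Context: The sequence $\{P_n(x)\}_{n\ge1}$ of rational functions of $x$ is defined by $P_1=P_2=1$ and, for $n\ge 2$: if $n$ is odd, $4(2x+n)P_{n+1}(x)=2(x+n)P_n(x)+(2x+n)P_n(x+1)+(4x+n)\ell_n(x)$; if $n$ is even, $4P_{n+1}(x)=4(x+n)P_n(x)+2(2x+n+1)P_n(x+1)+(4x+n)\ell_{n-1}(x)$. Here for odd $r\ge1$, $\ell_r(x)=\prod_{j=1}^{(r-1)/2}(x+j)$ (the empty product equals $1$). Each $P_n$ is a polynomial of degree $m=\lfloor\frac{n-1}{2}\rfloor$; write $P_n(x)=\sum_{i=0}^{m}a_i(n)x^{m-i}$, with the convention $a_i(n)=0$ for $i>m$. *)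

theory Defs
  imports
    "HOL-Computational_Algebra.Computational_Algebra"
    "HOL-Computational_Algebra.Field_as_Ring"
begin

definition ratX :: "rat poly fract" where
  "ratX = to_fract [:0, 1:]"

text \<open>The substitution \<open>f(x) \<mapsto> f(x + 1)\<close>, computed on the normalized representation;
  the lemma below shows that every representation gives the same result.\<close>

definition ratfun_shift :: "rat poly fract \<Rightarrow> rat poly fract" where
  "ratfun_shift f =
     (case quot_of_fract f of (p, q) \<Rightarrow> Fract (pcompose p [:1, 1:]) (pcompose q [:1, 1:]))"

lemma ratfun_shift_Fract:
  assumes "q \<noteq> 0"
  shows "ratfun_shift (Fract p q) = Fract (pcompose p [:1, 1:]) (pcompose q [:1, 1:])"
proof -
  obtain p' q' where pq: "quot_of_fract (Fract p q) = (p', q')"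
    by fastforce
  have q': "q' \<noteq> 0"
    using snd_quot_of_fract_nonzero[of "Fract p q"] pq by simp
  have "Fract p q = Fract p' q'"
    using quot_to_fract_quot_of_fract[of "Fract p q"] pq by (simp add: quot_to_fract_def)
  then have "p * q' = p' * q"
    using assms q' by (simp add: eq_fract)
  then have "pcompose p [:1, 1:] * pcompose q' [:1, 1:] = pcompose p' [:1, 1:] * pcompose q [:1, 1:]"
    by (metis pcompose_mult)
  moreover have "pcompose q [:1, 1:] \<noteq> 0" "pcompose q' [:1, 1:] \<noteq> 0"
    using assms q' by (auto simp: pcompose_eq_0_iff)
  ultimately show ?thesis
    by (simp add: ratfun_shift_def pq eq_fract)
qed

text \<open>Only meaningful for odd \<open>r\<close>.\<close>

definition ell :: "nat \<Rightarrow> rat poly fract" where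
  "ell r = (\<Prod>j = 1..(r - 1) div 2. ratX + of_nat j)"

text \<open>The recurrence solved for its left-hand side, at \<open>n = k + 2\<close>; the lemmas below recover
  the multiplied-out form. The value at index 0 is a dummy.\<close>

fun Pseq :: "nat \<Rightarrow> rat poly fract" where
  "Pseq 0 = 0"
| "Pseq (Suc 0) = 1"
| "Pseq (Suc (Suc 0)) = 1"
| "Pseq (Suc (Suc (Suc k))) =
     (let n = Suc (Suc k) in
      if odd n then
        (2 * (ratX + of_nat n) * Pseq n + (2 * ratX + of_nat n) * ratfun_shift (Pseq n)
          + (4 * ratX + of_nat n) * ell n) / (4 * (2 * ratX + of_nat n))
      else
        (4 * (ratX + of_nat n) * Pseq n + 2 * (2 * ratX + of_nat n + 1) * ratfun_shift (Pseq n)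
          + (4 * ratX + of_nat n) * ell (n - 1)) / 4)"

lemma of_nat_ratfun: "(of_nat n :: rat poly fract) = to_fract [:of_nat n:]"
proof (induction n)
  case (Suc n)
  have "[:of_nat (Suc n) :: rat:] = 1 + [:of_nat n:]"
    by (simp add: one_pCons)
  with Suc show ?case
    by (simp only: of_nat_Suc to_fract_add to_fract_1)
qed simp

lemma numeral_ratfun: "(numeral n :: rat poly fract) = to_fract [:numeral n:]"
  using of_nat_ratfun[of "numeral n"] by simp

lemma two_ratX_add_nonzero: "2 * ratX + of_nat n \<noteq> 0"
proof -
  have "2 * ratX + of_nat n = to_fract ([:2:] * [:0, 1:] + [:of_nat n:])"
    by (simp only: ratX_def of_nat_ratfun numeral_ratfun to_fract_mult to_fract_add)
  then show ?thesis
    by (simp only: to_fract_eq_0_iff) simp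
qed

lemma four_ratfun_nonzero: "(4 :: rat poly fract) \<noteq> 0"
  unfolding numeral_ratfun to_fract_eq_0_iff by simp

lemma eq_divide_imp_mult_eq: "c \<noteq> 0 \<Longrightarrow> y = z / c \<Longrightarrow> c * y = z" for c :: "'a::field"
  by simp

lemma Pseq_odd:
  assumes "n \<ge> 2" "odd n"
  shows "4 * (2 * ratX + of_nat n) * Pseq (n + 1) =
    2 * (ratX + of_nat n) * Pseq n + (2 * ratX + of_nat n) * ratfun_shift (Pseq n)
      + (4 * ratX + of_nat n) * ell n"
proof -
  obtain k where n: "Suc (Suc k) = n"
    using assms(1) by (auto dest: le_Suc_ex)
  have "Pseq (n + 1) = (2 * (ratX + of_nat n) * Pseq n
      + (2 * ratX + of_nat n) * ratfun_shift (Pseq n) + (4 * ratX + of_nat n) * ell n)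
      / (4 * (2 * ratX + of_nat n))"
    using Pseq.simps(4)[of k] assms(2) unfolding n Let_def
    by (simp only: Suc_eq_plus1 if_True not_False_eq_True)
  moreover have "4 * (2 * ratX + of_nat n) \<noteq> 0"
    unfolding mult_eq_0_iff using two_ratX_add_nonzero[of n] four_ratfun_nonzero by blast
  ultimately show ?thesis
    by (rule eq_divide_imp_mult_eq[rotated])
qed

lemma Pseq_even:
  assumes "n \<ge> 2" "even n"
  shows "4 * Pseq (n + 1) =
    4 * (ratX + of_nat n) * Pseq n + 2 * (2 * ratX + of_nat n + 1) * ratfun_shift (Pseq n)
      + (4 * ratX + of_nat n) * ell (n - 1)"
proof -
  obtain k where n: "Suc (Suc k) = n"
    using assms(1) by (auto dest: le_Suc_ex)
  have "Pseq (n + 1) = (4 * (ratX + of_nat n) * Pseq n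
      + 2 * (2 * ratX + of_nat n + 1) * ratfun_shift (Pseq n) + (4 * ratX + of_nat n) * ell (n - 1)) / 4"
    using Pseq.simps(4)[of k] assms(2) unfolding n Let_def
    by (simp only: Suc_eq_plus1 if_False not_True_eq_False)
  then show ?thesis
    by (rule eq_divide_imp_mult_eq[OF four_ratfun_nonzero])
qed

text \<open>The polynomial representing \<open>P\<^sub>n\<close>. It is unspecified unless \<open>P\<^sub>n\<close> is a polynomial.\<close>

definition Ppoly :: "nat \<Rightarrow> rat poly" where
  "Ppoly n = (THE p. Pseq n = to_fract p)"

definition acoef :: "nat \<Rightarrow> nat \<Rightarrow> rat" where
  "acoef i n = (let m = (n - 1) div 2 in if i \<le> m then coeff (Ppoly n) (m - i) else 0)"

end

theory Submission
  imports Defs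
begin

text \<open>With \<open>m = (n - 1) div 2\<close> and \<open>c\<^sub>n = 1\<close> or \<open>1/2\<close> according to the parity of \<open>n\<close>, the recurrence has the
  closed solution \<open>P\<^sub>n(x) = c\<^sub>n \<Sum>\<^sub>k binom(n, 2k+1) k! (x+k+1) \<cdots> (x+m)\<close>. After division by \<open>(x+1) \<cdots> (x+m)\<close>
  the odd and the even recurrence become one and the same identity, which telescopes. The coefficient
  \<open>a\<^sub>i(n)\<close> is then \<open>c\<^sub>n\<close> times the sum over \<open>k \<le> i\<close> of \<open>binom(n, 2k+1) k!\<close> times the elementary symmetric
  polynomial of degree \<open>i - k\<close> in \<open>k+1, \<dots>, m\<close>. The latter is a polynomial in \<open>m\<close> of degree \<open>2(i-k)\<close>
  with positive leading coefficient, so every summand has degree exactly \<open>2i+1\<close> and nothing cancels.\<close>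

section \<open>Agreement of polynomials at natural numbers, and the ratio of adjacent
  binomials\<close>

text \<open>A nonzero difference would have infinitely many roots. This permits checking identities
  only at natural points, where every denominator \<open>x + j\<close> with \<open>j >= 1\<close> is
  positive.\<close>

lemma poly_eqI_of_nat:
  fixes p q :: "'a::{idom,ring_char_0} poly"
  assumes "\<And>k. poly p (of_nat k) = poly q (of_nat k)"
  shows "p = q"
proof (rule ccontr)
  assume "p \<noteq> q"
  then have "finite {x. poly (p - q) x = 0}"
    by (intro poly_roots_finite) simp
  moreover have "range of_nat \<subseteq> {x. poly (p - q) x = 0}"
    using assms by auto
  moreover have "infinite (range (of_nat :: nat \<Rightarrow> 'a))"
    by (simp add: finite_image_iff inj_of_nat)
  ultimately show False
    using finite_subset by blast
qed

text \<open>The subtraction is taken in the field, so the relation also holds for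
  \<open>k > n\<close>, where both binomials are 0. It drives the telescoping below.\<close>

lemma of_nat_binomial_Suc:
  "of_nat (Suc k) * of_nat (n choose Suc k)
     = (of_nat n - of_nat k :: 'a::field_char_0) * of_nat (n choose k)"
proof (cases "k \<le> n")
  case True
  have "Suc k * (n choose Suc k) = (n - k) * (n choose k)"
    by (metis binomial_absorb_comp binomial_absorption mult.commute)
  then show ?thesis
    using True by (metis of_nat_diff of_nat_mult)
qed (simp add: binomial_eq_0)

section \<open>The normalized binomial sum and its recurrence in \<open>n\<close>\<close>

text \<open>This is the reciprocal of the generalized binomial coefficient
  \<open>binom(x + k, k)\<close>.\<close>

definition binsum_term :: "nat \<Rightarrow> rat \<Rightarrow> rat" where
  "binsum_term k x = fact k / (\<Prod>j = 1..k. x + of_nat j)"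

definition binsum :: "nat \<Rightarrow> rat \<Rightarrow> rat" where
  "binsum n x = (\<Sum>k<n. of_nat (n choose (2 * k + 1)) * binsum_term k x)"

text \<open>Both sides are \<open>(x+1) (x+2) ... (x+k+1)\<close>.\<close>

lemma prod_shift:
  "(\<Prod>j = 1..k. (x + 1) + of_nat j) * (x + 1) = (\<Prod>j = 1..k. x + of_nat j) * (x + of_nat k + 1)"
  for x :: "'a::comm_ring_1"
proof (induction k)
  case (Suc k)
  have "(\<Prod>j = 1..Suc k. (x + 1) + of_nat j) * (x + 1)
      = ((\<Prod>j = 1..k. (x + 1) + of_nat j) * (x + 1)) * (x + of_nat (Suc k) + 1)"
    by (simp add: algebra_simps)
  also have "\<dots> = (\<Prod>j = 1..Suc k. x + of_nat j) * (x + of_nat (Suc k) + 1)"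
    unfolding Suc.IH by (simp add: algebra_simps)
  finally show ?case .
qed simp

lemma prod_add_of_nat_pos: "x \<ge> 0 \<Longrightarrow> (\<Prod>j = 1..k. x + of_nat j) > (0::rat)"
  by (intro prod_pos) (auto intro: add_nonneg_pos)

lemma binsum_term_Suc:
  assumes "x \<ge> 0"
  shows "binsum_term (Suc k) x = binsum_term k x * (of_nat k + 1) / (x + of_nat k + 1)"
  using assms by (simp add: binsum_term_def algebra_simps)

lemma binsum_term_shift:
  assumes "x \<ge> 0"
  shows "binsum_term k (x + 1) = binsum_term k x * (x + 1) / (x + of_nat k + 1)"
proof -
  have "(\<Prod>j = 1..k. x + 1 + of_nat j) > 0" "(\<Prod>j = 1..k. x + of_nat j) > 0" "x + of_nat k + 1 > 0"
    using assms prod_add_of_nat_pos[of "x + 1"] prod_add_of_nat_pos[of x] by auto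
  then show ?thesis
    using prod_shift[of x k] assms unfolding binsum_term_def
    by (simp only: frac_eq_eq times_divide_eq_left times_divide_eq_right divide_divide_eq_left
        mult_eq_0_iff simp_thms less_imp_neq[symmetric]) (metis mult.assoc mult.commute)
qed

text \<open>Summands with \<open>2 * k + 1 > n\<close> vanish, so the cutoff is flexible and sums
  for \<open>n\<close> and \<open>n + 1\<close> can share one range. Two cutoffs are compared
  through their maximum.\<close>

lemma binsum_extend:
  assumes "n \<le> 2 * K"
  shows "binsum n x = (\<Sum>k<K. of_nat (n choose (2 * k + 1)) * binsum_term k x)"
proof -
  have "(\<Sum>k<N. of_nat (n choose (2 * k + 1)) * binsum_term k x)
      = (\<Sum>k<N'. of_nat (n choose (2 * k + 1)) * binsum_term k x)"
    if "n \<le> 2 * N" "N \<le> N'" for N N'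
    using that by (intro sum.mono_neutral_left) (auto simp: binomial_eq_0)
  from this[of n "max n K"] this[of K "max n K"] assms show ?thesis
    by (simp add: binsum_def)
qed

text \<open>The remainder after \<open>K\<close> summands was found by Zeilberger's method; it vanishes for \<open>n < 2 * K\<close>.\<close>

lemma binsum_telescope:
  assumes "x \<ge> 0"
  shows "(\<Sum>k<K. binsum_term k x *
      (2 * (2 * x + of_nat n) * of_nat (Suc n choose (2 * k + 1))
        - 2 * (x + of_nat n) * of_nat (n choose (2 * k + 1))
        - (2 * x + of_nat n) * (2 * x + of_nat n + 1) / (2 * (x + of_nat k + 1))
            * of_nat (n choose (2 * k + 1))))
    = 4 * x + of_nat n - of_nat (n choose (2 * K)) * binsum_term K x * (4 * x + 2 * of_nat K + of_nat n)"
proof (induction K)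
  case 0
  then show ?case by (simp add: binsum_term_def)
next
  case (Suc k)
  define a b c where "a = (of_nat (n choose (2 * k)) :: rat)"
    and "b = (of_nat (n choose (2 * k + 1)) :: rat)" and "c = (of_nat (n choose (2 * Suc k)) :: rat)"
  define N \<kappa> t where "N = (of_nat n :: rat)" and "\<kappa> = (of_nat k :: rat)" and "t = binsum_term k x"
  have ab: "(2 * \<kappa> + 1) * b = (N - 2 * \<kappa>) * a"
    using of_nat_binomial_Suc[of "2 * k" n, where 'a = rat]
    by (simp add: a_def b_def N_def \<kappa>_def algebra_simps)
  have bc: "(2 * \<kappa> + 2) * c = (N - 2 * \<kappa> - 1) * b"
    using of_nat_binomial_Suc[of "2 * k + 1" n, where 'a = rat]
    by (simp add: c_def b_def N_def \<kappa>_def algebra_simps)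
  have S: "of_nat (Suc n choose (2 * k + 1)) = a + b"
    by (simp add: a_def b_def)
  have pos: "x + \<kappa> + 1 \<noteq> 0"
    using assms by (simp add: \<kappa>_def add_nonneg_eq_0_iff)
  have expand: "u * (a * H - c * (d / w) * H') = a * u * H - c * (u * d / w) * H'"
    for u H d w H' by (simp add: algebra_simps)
  have divide: "A - B / (2 * w) * b = C * H - c * (d / w) * H'"
    if "w \<noteq> 0" "w * A - B / 2 * b = w * C * H - c * d * H'" for w A B C H d H'
    using arg_cong[OF that(2), of "\<lambda>u. u / w"] that(1) by (simp add: diff_divide_distrib)
  \<comment> \<open>The summand is the drop of the remainder from \<open>k\<close> to
    \<open>k + 1\<close>. Cleared of the denominator, this is a polynomial identity modulo the two
    binomial ratios \<open>ab\<close> and \<open>bc\<close>.\<close>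
  have "(x + \<kappa> + 1) * (2 * (2 * x + N) * (a + b) - 2 * (x + N) * b)
        - (2 * x + N) * (2 * x + N + 1) / 2 * b
      = (x + \<kappa> + 1) * a * (4 * x + 2 * \<kappa> + N) - c * (\<kappa> + 1) * (4 * x + 2 * (\<kappa> + 1) + N)"
    using ab bc by algebra
  then have "2 * (2 * x + N) * (a + b) - 2 * (x + N) * b
        - (2 * x + N) * (2 * x + N + 1) / (2 * (x + \<kappa> + 1)) * b
      = a * (4 * x + 2 * \<kappa> + N) - c * ((\<kappa> + 1) / (x + \<kappa> + 1)) * (4 * x + 2 * (\<kappa> + 1) + N)"
    by (rule divide[OF pos])
  then have "t * (2 * (2 * x + N) * (a + b) - 2 * (x + N) * b
        - (2 * x + N) * (2 * x + N + 1) / (2 * (x + \<kappa> + 1)) * b)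
      = a * t * (4 * x + 2 * \<kappa> + N) - c * (t * (\<kappa> + 1) / (x + \<kappa> + 1)) * (4 * x + 2 * (\<kappa> + 1) + N)"
    by (simp only: expand)
  moreover have "binsum_term (Suc k) x = t * (\<kappa> + 1) / (x + \<kappa> + 1)"
    using binsum_term_Suc[OF assms] by (simp add: t_def \<kappa>_def)
  moreover have "of_nat (Suc k) = \<kappa> + 1"
    by (simp add: \<kappa>_def)
  ultimately show ?case
    using Suc.IH unfolding sum.lessThan_Suc S
    unfolding a_def[symmetric] b_def[symmetric] c_def[symmetric] N_def[symmetric] \<kappa>_def[symmetric]
      t_def[symmetric]
    by simp
qed

text \<open>The telescoped sum is taken up to \<open>K = n + 1\<close>, where the remainder contains
  \<open>n choose (2 * n + 2) = 0\<close>. No parity of \<open>n\<close> enters, so both given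
  recurrences will follow from this one.\<close>

lemma binsum_rec:
  assumes "x \<ge> 0"
  shows "2 * (2 * x + of_nat n) * binsum (Suc n) x =
    2 * (x + of_nat n) * binsum n x
    + (2 * x + of_nat n) * (2 * x + of_nat n + 1) / (2 * (x + 1)) * binsum n (x + 1)
    + (4 * x + of_nat n)"
proof -
  let ?K = "Suc n"
  have x1: "x + 1 \<noteq> 0" using assms by (simp add: add_nonneg_eq_0_iff)
  \<comment> \<open>The weight \<open>1 / (x + 1)\<close> cancels the factor \<open>x + 1\<close>
    created by the shift, leaving a multiple of the unshifted term.\<close>
  have t: "binsum_term k (x + 1) / (2 * (x + 1)) = binsum_term k x / (2 * (x + of_nat k + 1))" for k
  proof -
    have "b * y / z / (2 * y) = b / (2 * z)" if "y \<noteq> 0" for b y z :: rat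
      using that by simp
    then show ?thesis
      unfolding binsum_term_shift[OF assms] using x1 by blast
  qed
  have rearrange: "u * v * (c * (t / d)) = t * (u * v / d * c)" for u v c t d :: rat
    by simp
  have "(2 * x + of_nat n) * (2 * x + of_nat n + 1) / (2 * (x + 1)) * binsum n (x + 1)
      = (2 * x + of_nat n) * (2 * x + of_nat n + 1) *
         (\<Sum>k<?K. of_nat (n choose (2 * k + 1)) * (binsum_term k (x + 1) / (2 * (x + 1))))"
    by (simp add: binsum_extend[of n ?K] sum_divide_distrib[symmetric])
  then have shift: "(2 * x + of_nat n) * (2 * x + of_nat n + 1) / (2 * (x + 1)) * binsum n (x + 1)
      = (\<Sum>k<?K. binsum_term k x * ((2 * x + of_nat n) * (2 * x + of_nat n + 1) / (2 * (x + of_nat k + 1))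
            * of_nat (n choose (2 * k + 1))))"
    unfolding t sum_distrib_left by (simp only: rearrange)
  have "n choose (2 * ?K) = 0" by (simp add: binomial_eq_0)
  then have "(\<Sum>k<?K. binsum_term k x *
      (2 * (2 * x + of_nat n) * of_nat (Suc n choose (2 * k + 1))
        - 2 * (x + of_nat n) * of_nat (n choose (2 * k + 1))
        - (2 * x + of_nat n) * (2 * x + of_nat n + 1) / (2 * (x + of_nat k + 1))
            * of_nat (n choose (2 * k + 1)))) = 4 * x + of_nat n"
    unfolding binsum_telescope[OF assms] by simp
  moreover have "c * binsum n' x = (\<Sum>k<?K. binsum_term k x * (c * of_nat (n' choose (2 * k + 1))))"
    if "n' \<le> 2 * ?K" for c n'
    unfolding binsum_extend[OF that] sum_distrib_left by (simp only: mult.left_commute mult.commute)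
  from this[of n "2 * (x + of_nat n)"] this[of "Suc n" "2 * (2 * x + of_nat n)"]
  have "2 * (2 * x + of_nat n) * binsum (Suc n) x = (\<Sum>k<?K. binsum_term k x *
        (2 * (2 * x + of_nat n) * of_nat (Suc n choose (2 * k + 1))))"
    "2 * (x + of_nat n) * binsum n x = (\<Sum>k<?K. binsum_term k x *
        (2 * (x + of_nat n) * of_nat (n choose (2 * k + 1))))"
    by simp_all
  ultimately show ?thesis
    unfolding shift right_diff_distrib sum_subtractf by linarith
qed

section \<open>The closed form satisfies both recurrences\<close>

definition rising :: "nat \<Rightarrow> nat \<Rightarrow> rat poly" where
  "rising k m = (\<Prod>j\<in>{k<..m}. [:of_nat j, 1:])"

definition Pclosed :: "nat \<Rightarrow> rat poly" where
  "Pclosed n = smult (if odd n then 1 else 1 / 2)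
     (\<Sum>k\<le>(n - 1) div 2. smult (of_nat (n choose (2 * k + 1)) * fact k) (rising k ((n - 1) div 2)))"

lemma poly_rising_0: "poly (rising 0 m) x = (\<Prod>j = 1..m. x + of_nat j)"
  by (simp add: rising_def poly_prod add.commute atLeastSucAtMost_greaterThanAtMost[symmetric])

text \<open>The product splits as \<open>rising 0 m = rising 0 k * rising k m\<close>, and
  \<open>x >= 0\<close> keeps the first factor nonzero.\<close>

lemma poly_rising:
  assumes "k \<le> m" "x \<ge> 0"
  shows "fact k * poly (rising k m) x = poly (rising 0 m) x * binsum_term k x"
proof -
  have "{0<..m} = {0<..k} \<union> {k<..m}" "{0<..k} \<inter> {k<..m} = {}"
    using assms(1) by auto
  then have "rising 0 m = rising 0 k * rising k m"
    unfolding rising_def by (simp add: prod.union_disjoint)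
  moreover have "poly (rising 0 k) x \<noteq> 0"
    using prod_add_of_nat_pos[OF assms(2), of k] unfolding poly_rising_0 by (metis less_irrefl)
  ultimately show ?thesis
    unfolding binsum_term_def poly_rising_0[symmetric] by simp
qed

lemma poly_Pclosed:
  assumes "n \<ge> 1" "x \<ge> 0"
  shows "poly (Pclosed n) x =
    (if odd n then 1 else 1 / 2) * poly (rising 0 ((n - 1) div 2)) x * binsum n x"
proof -
  let ?m = "(n - 1) div 2"
  \<comment> \<open>Hence the sum up to \<open>?m\<close> already contains every nonzero summand of
    \<open>binsum n x\<close>.\<close>
  have K: "n \<le> 2 * Suc ?m" using assms(1) by presburger
  let ?c = "if odd n then 1 else 1 / 2 :: rat"
  have "poly (Pclosed n) x = ?c * (\<Sum>k\<le>?m. of_nat (n choose (2 * k + 1)) * (fact k * poly (rising k ?m) x))"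
    by (simp only: Pclosed_def poly_smult poly_sum mult.assoc)
  also have "\<dots> = ?c * (\<Sum>k\<le>?m. of_nat (n choose (2 * k + 1)) * (poly (rising 0 ?m) x * binsum_term k x))"
    using poly_rising[OF _ assms(2)] by simp
  also have "\<dots> = ?c * poly (rising 0 ?m) x * binsum n x"
    unfolding binsum_extend[OF K] lessThan_Suc_atMost sum_distrib_left mult.assoc
    by (simp only: mult.left_commute)
  finally show ?thesis .
qed

lemma poly_rising_0_shift:
  assumes "x \<ge> 0"
  shows "poly (rising 0 m) (x + 1) = poly (rising 0 m) x * (x + of_nat m + 1) / (x + 1)"
proof -
  have "x + 1 \<noteq> 0" using assms by (simp add: add_nonneg_eq_0_iff)
  then show ?thesis
    using prod_shift[of x m] by (simp add: poly_rising_0 field_simps)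
qed

text \<open>For \<open>n = 2 * m + 1\<close> the index \<open>m\<close> is the same at
  \<open>n + 1\<close>, and shifting \<open>rising 0 m\<close> produces
  \<open>x + m + 1 = (2 * x + n + 1) / 2\<close> over \<open>x + 1\<close>. The claim is then
  \<open>R = rising 0 m\<close> times \<open>binsum_rec\<close>.\<close>

lemma Pclosed_odd:
  assumes "odd n"
  shows "[:4:] * ([:of_nat n, 2:] * Pclosed (n + 1)) =
    [:2:] * ([:of_nat n, 1:] * Pclosed n) + [:of_nat n, 2:] * pcompose (Pclosed n) [:1, 1:]
      + [:of_nat n, 4:] * rising 0 ((n - 1) div 2)"
proof (rule poly_eqI_of_nat)
  fix k :: nat
  define x where "x = (of_nat k :: rat)"
  have x: "x \<ge> 0" "x + 1 \<ge> 0" "x + 1 \<noteq> 0" by (simp_all add: x_def add_nonneg_eq_0_iff)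
  obtain m where n: "n = 2 * m + 1" using assms by (elim oddE)
  define S S1 S' N R where "S = binsum n x" "S1 = binsum n (x + 1) / (x + 1)" "S' = binsum (Suc n) x"
    "N = (of_nat n :: rat)" "R = poly (rising 0 m) x"
  note defs = this
  have N: "N = 2 * of_nat m + 1" by (simp add: defs n)
  have rec: "2 * (2 * x + N) * S' = 2 * (x + N) * S + (2 * x + N) * (2 * x + N + 1) / 2 * S1
      + (4 * x + N)"
    using binsum_rec[OF x(1), of n] by (simp add: defs)
  have P: "poly (Pclosed (n + 1)) x = R * S' / 2" "poly (Pclosed n) x = R * S"
    "poly (Pclosed n) (x + 1) = R * ((2 * x + N + 1) / 2) * S1"
    using poly_Pclosed[of n x] poly_Pclosed[of n "x + 1"] poly_Pclosed[of "n + 1" x] x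
    by (simp_all add: defs n poly_rising_0_shift)
  have "4 * ((2 * x + N) * poly (Pclosed (n + 1)) x) = R * (2 * (2 * x + N) * S')"
    unfolding P(1) by (simp add: field_simps)
  also have "\<dots> = 2 * ((x + N) * poly (Pclosed n) x)
      + (2 * x + N) * poly (Pclosed n) (x + 1) + (4 * x + N) * R"
    unfolding rec P(2,3) by (simp add: algebra_simps add_divide_distrib)
  finally have "4 * ((2 * x + N) * poly (Pclosed (n + 1)) x) = 2 * ((x + N) * poly (Pclosed n) x)
      + (2 * x + N) * poly (Pclosed n) (x + 1) + (4 * x + N) * R" .
  moreover have "poly [:of_nat n, c:] x = c * x + N" "poly [:of_nat n + 1, c:] x = c * x + N + 1"
    "poly [:c:] x = c" "poly [:1, 1:] x = x + 1" "poly (rising 0 ((n - 1) div 2)) x = R" for c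
    by (simp_all add: defs n)
  ultimately show "poly ([:4:] * ([:of_nat n, 2:] * Pclosed (n + 1))) (of_nat k) =
    poly ([:2:] * ([:of_nat n, 1:] * Pclosed n) + [:of_nat n, 2:] * pcompose (Pclosed n) [:1, 1:]
      + [:of_nat n, 4:] * rising 0 ((n - 1) div 2)) (of_nat k)"
    by (simp only: poly_add poly_mult poly_pcompose x_def[symmetric] mult_1_left)
qed

text \<open>For \<open>n = 2 * m + 2\<close> the index grows to \<open>m + 1\<close>. The new factor
  \<open>x + m + 1 = (2 * x + n) / 2\<close> supplies the \<open>2 * x + n\<close> that the left
  side lacks compared with \<open>binsum_rec\<close>.\<close>

lemma Pclosed_even:
  assumes "even n" "n \<ge> 2"
  shows "[:4:] * Pclosed (n + 1) =
    [:4:] * ([:of_nat n, 1:] * Pclosed n) + [:2:] * ([:of_nat n + 1, 2:] * pcompose (Pclosed n) [:1, 1:])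
      + [:of_nat n, 4:] * rising 0 ((n - 1) div 2)"
proof (rule poly_eqI_of_nat)
  fix k :: nat
  define x where "x = (of_nat k :: rat)"
  have x: "x \<ge> 0" "x + 1 \<ge> 0" "x + 1 \<noteq> 0" by (simp_all add: x_def add_nonneg_eq_0_iff)
  obtain m where n: "n = 2 * m + 2"
    using assms by (metis dvdE le_Suc_ex nat_1_add_1 mult_2 add.commute even_add even_two_times_div_two)
  define S S1 S' N R where "S = binsum n x" "S1 = binsum n (x + 1) / (x + 1)" "S' = binsum (Suc n) x"
    "N = (of_nat n :: rat)" "R = poly (rising 0 m) x"
  note defs = this
  have N: "N = 2 * of_nat m + 2" by (simp add: defs n)
  have rec: "2 * (2 * x + N) * S' = 2 * (x + N) * S + (2 * x + N) * (2 * x + N + 1) / 2 * S1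
      + (4 * x + N)"
    using binsum_rec[OF x(1), of n] by (simp add: defs)
  have R': "poly (rising 0 (Suc m)) x = R * ((2 * x + N) / 2)"
    by (simp add: poly_rising_0 defs n)
  have m: "(n - 1) div 2 = m" "(n + 1 - 1) div 2 = Suc m" by (simp_all add: n)
  have xm: "x + of_nat m + 1 = (2 * x + N) / 2"
    by (simp add: N)
  have P: "poly (Pclosed (n + 1)) x = R * ((2 * x + N) / 2) * S'" "poly (Pclosed n) x = R * S / 2"
    "poly (Pclosed n) (x + 1) = R * ((2 * x + N) / 2) * S1 / 2"
  proof -
    have half: "poly (Pclosed n) y = 1 / 2 * poly (rising 0 m) y * binsum n y" if "y \<ge> 0" for y
      using poly_Pclosed[of n y] assms that unfolding m(1) by simp
    show "poly (Pclosed n) x = R * S / 2"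
      by (simp add: half[OF x(1)] defs)
    show "poly (Pclosed n) (x + 1) = R * ((2 * x + N) / 2) * S1 / 2"
      unfolding half[OF x(2)] poly_rising_0_shift[OF x(1)] xm by (simp add: defs(2,5))
    show "poly (Pclosed (n + 1)) x = R * ((2 * x + N) / 2) * S'"
      using poly_Pclosed[of "n + 1" x] x(1) assms(1) unfolding m(2) R' by (simp add: defs(3))
  qed
  have "4 * poly (Pclosed (n + 1)) x = R * (2 * (2 * x + N) * S')"
    unfolding P(1) by simp
  also have "\<dots> = 4 * ((x + N) * poly (Pclosed n) x)
      + 2 * ((2 * x + N + 1) * poly (Pclosed n) (x + 1)) + (4 * x + N) * R"
    unfolding rec P(2,3) by (simp add: algebra_simps add_divide_distrib)
  finally have "4 * poly (Pclosed (n + 1)) x = 4 * ((x + N) * poly (Pclosed n) x)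
      + 2 * ((2 * x + N + 1) * poly (Pclosed n) (x + 1)) + (4 * x + N) * R" .
  moreover have "poly [:of_nat n, c:] x = c * x + N" "poly [:of_nat n + 1, c:] x = c * x + N + 1"
    "poly [:c:] x = c" "poly [:1, 1:] x = x + 1" "poly (rising 0 ((n - 1) div 2)) x = R" for c
    by (simp_all add: defs n)
  ultimately show "poly ([:4:] * Pclosed (n + 1)) (of_nat k) =
    poly ([:4:] * ([:of_nat n, 1:] * Pclosed n) + [:2:] * ([:of_nat n + 1, 2:] * pcompose (Pclosed n) [:1, 1:])
      + [:of_nat n, 4:] * rising 0 ((n - 1) div 2)) (of_nat k)"
    by (simp only: poly_add poly_mult poly_pcompose x_def[symmetric] mult_1_left)
qed

section \<open>Transfer to the sequence of rational functions\<close>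

lemma to_fract_linear: "of_nat a * ratX + of_nat b = to_fract [:of_nat b, of_nat a:]"
  by (simp add: ratX_def of_nat_ratfun flip: to_fract_mult to_fract_add)

lemma ell_eq: "ell r = to_fract (rising 0 ((r - 1) div 2))"
proof -
  have "to_fract (\<Prod>j\<in>A. f j) = (\<Prod>j\<in>A. to_fract (f j))" if "finite A" for A :: "nat set" and f :: "nat \<Rightarrow> rat poly"
    using that by induction simp_all
  then show ?thesis
    using to_fract_linear[of 1]
    by (simp add: ell_def rising_def atLeastSucAtMost_greaterThanAtMost[symmetric])
qed

lemma ratfun_shift_to_fract: "ratfun_shift (to_fract p) = to_fract (pcompose p [:1, 1:])"
  using ratfun_shift_Fract[of 1 p] by (simp add: to_fract_def pcompose_1)

text \<open>Induction along the recurrence; the step from 1 to 2 is checked directly, since the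
  recurrence starts at 2. The factors multiplying the new term are nonzero and cancel.\<close>

lemma Pseq_eq: "n \<ge> 1 \<Longrightarrow> Pseq n = to_fract (Pclosed n)"
proof (induction n rule: dec_induct)
  case base
  show ?case by (simp add: Pclosed_def rising_def flip: one_pCons)
next
  case (step n)
  have lin: "2 * ratX + of_nat n = to_fract [:of_nat n, 2:]" "ratX + of_nat n = to_fract [:of_nat n, 1:]"
     "4 * ratX + of_nat n = to_fract [:of_nat n, 4:]" "2 * ratX + of_nat n + 1 = to_fract [:of_nat n + 1, 2:]"
    using to_fract_linear[of 2 n] to_fract_linear[of 1 n] to_fract_linear[of 4 n]
      to_fract_linear[of 2 "Suc n"] by (simp_all add: ac_simps)
  consider "n = 1" | "odd n" "n \<ge> 2" | "even n" "n \<ge> 2"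
    using step.hyps by linarith
  then show ?case
  proof cases
    case 1
    then show ?thesis by (simp add: Pclosed_def rising_def numeral_2_eq_2 flip: one_pCons)
  next
    case 2
    have "4 * (2 * ratX + of_nat n) * Pseq (n + 1) = to_fract ([:4:] * ([:of_nat n, 2:] * Pclosed (n + 1)))"
      unfolding Pseq_odd[OF 2(2,1)] unfolding step.IH ratfun_shift_to_fract ell_eq Pclosed_odd[OF 2(1)]
        to_fract_mult to_fract_add lin unfolding numeral_ratfun by (simp only: mult.assoc)
    also have "\<dots> = 4 * (2 * ratX + of_nat n) * to_fract (Pclosed (n + 1))"
      unfolding to_fract_mult lin unfolding numeral_ratfun by (simp only: mult.assoc)
    finally show ?thesis
      using four_ratfun_nonzero two_ratX_add_nonzero[of n] by simp
  next
    case 3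
    \<comment> \<open>For even \<open>n\<close>, the product \<open>ell (n - 1)\<close> therefore
      has the same length \<open>m\<close> as for the closed form.\<close>
    then have "(n - 1 - 1) div 2 = (n - 1) div 2" by presburger
    then have "4 * Pseq (n + 1) = to_fract ([:4:] * Pclosed (n + 1))"
      unfolding Pseq_even[OF 3(2,1)] lin(4) unfolding step.IH ratfun_shift_to_fract ell_eq Pclosed_even[OF 3]
        to_fract_mult to_fract_add lin unfolding numeral_ratfun by (simp only: mult.assoc)
    also have "\<dots> = 4 * to_fract (Pclosed (n + 1))"
      unfolding to_fract_mult numeral_ratfun ..
    finally show ?thesis
      using four_ratfun_nonzero by simp
  qed
qed

lemma Ppoly_eq: "n \<ge> 1 \<Longrightarrow> Ppoly n = Pclosed n"
  unfolding Ppoly_def by (rule the_equality) (simp_all add: Pseq_eq)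

section \<open>Coefficients as elementary symmetric polynomials\<close>

text \<open>This is the elementary symmetric polynomial of degree \<open>r\<close> in
  \<open>k+1, ..., m\<close>. The factors \<open>1 + j x\<close> make the coefficient index
  independent of \<open>m\<close>.\<close>

definition rising_coeff :: "nat \<Rightarrow> nat \<Rightarrow> nat \<Rightarrow> rat" where
  "rising_coeff k r m = coeff (\<Prod>j\<in>{k<..m}. [:1, of_nat j:]) r"

lemma degree_rising: "degree (rising k m) = m - k"
  unfolding rising_def by (subst degree_prod_eq_sum_degree) auto

text \<open>Reflection turns each \<open>x + j\<close> into \<open>1 + j x\<close> and coefficient
  \<open>m - i\<close> into \<open>i - k\<close>, the degree being \<open>m - k\<close>. For
  \<open>k > i\<close> the index exceeds the degree.\<close>

lemma coeff_rising:
  "coeff (rising k m) (m - i) = (if k \<le> i then rising_coeff k (i - k) m else 0)" if "i \<le> m" "k \<le> m"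
proof -
  have "reflect_poly (rising k m) = (\<Prod>j\<in>{k<..m}. reflect_poly [:of_nat j, 1:])"
    unfolding rising_def by (rule reflect_poly_prod)
  also have "\<dots> = (\<Prod>j\<in>{k<..m}. [:1, of_nat j:])"
    by (simp add: reflect_poly_def)
  finally have "rising_coeff k (i - k) m = coeff (reflect_poly (rising k m)) (i - k)"
    by (simp add: rising_coeff_def)
  then show ?thesis
    using that by (auto simp: coeff_reflect_poly degree_rising intro: coeff_eq_0)
qed

lemma degree_Pclosed: "degree (Pclosed n) \<le> (n - 1) div 2"
  unfolding Pclosed_def
  by (intro order.trans[OF degree_smult_le] degree_sum_le order.trans[OF degree_smult_le])
     (auto simp: degree_rising)

lemma rising_coeff_eq_0: "m < k + r \<Longrightarrow> k \<le> m \<Longrightarrow> rising_coeff k r m = 0"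
  unfolding rising_coeff_def
  by (rule coeff_eq_0, rule le_less_trans[OF degree_prod_sum_le])
     (auto intro!: le_less_trans[OF sum_bounded_above[where K = 1]])

text \<open>Summands with \<open>k > i\<close> contribute nothing, so the range no longer depends on
  \<open>n\<close>. The formula also respects the convention for \<open>i > m\<close>: either the
  binomial vanishes or the symmetric polynomial has more factors than variables.\<close>

lemma acoef_eq:
  assumes "n \<ge> 1"
  shows "acoef i n = (if odd n then 1 else 1 / 2) *
    (\<Sum>k\<le>i. of_nat (n choose (2 * k + 1)) * fact k * rising_coeff k (i - k) ((n - 1) div 2))"
proof -
  define m where "m = (n - 1) div 2"
  let ?f = "\<lambda>k. of_nat (n choose (2 * k + 1)) * fact k * rising_coeff k (i - k) m"
  have big: "n choose (2 * k + 1) = 0" if "k > m" for k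
    using that assms unfolding m_def by (intro binomial_eq_0) presburger
  show ?thesis
  proof (cases "i \<le> m")
    case True
    have "acoef i n = coeff (Pclosed n) (m - i)"
      using True Ppoly_eq[OF assms] by (simp only: acoef_def m_def Let_def if_True)
    also have "\<dots> = (if odd n then 1 else 1 / 2) *
        (\<Sum>k\<le>m. of_nat (n choose (2 * k + 1)) * fact k * coeff (rising k m) (m - i))"
      by (simp only: Pclosed_def m_def[symmetric] coeff_smult coeff_sum)
    also have "(\<Sum>k\<le>m. of_nat (n choose (2 * k + 1)) * fact k * coeff (rising k m) (m - i))
        = (\<Sum>k\<le>m. if k \<le> i then ?f k else 0)"
      by (intro sum.cong) (simp_all add: coeff_rising[OF True])
    also have "(\<Sum>k\<le>m. if k \<le> i then ?f k else 0) = (\<Sum>k\<le>i. ?f k)"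
      using True by (intro sum.mono_neutral_cong_right) auto
    finally show ?thesis by (simp add: m_def)
  next
    case False
    have "(\<Sum>k\<le>i. ?f k) = 0"
    proof (intro sum.neutral ballI)
      fix k assume "k \<in> {..i}"
      then show "?f k = 0"
        using big[of k] rising_coeff_eq_0[of m k "i - k"] False by (cases "k \<le> m") auto
    qed
    then show ?thesis
      using False unfolding acoef_def Let_def m_def[symmetric] by (simp only: if_False mult_zero_right)
  qed
qed

section \<open>Exact degree with positive leading coefficient\<close>

text \<open>Positivity makes exact degree survive addition, as leading terms cannot cancel.\<close>

definition pos_deg :: "nat \<Rightarrow> rat poly \<Rightarrow> bool" where
  "pos_deg d p \<longleftrightarrow> degree p = d \<and> lead_coeff p > 0"

lemma pos_degI: "degree p \<le> d \<Longrightarrow> coeff p d > 0 \<Longrightarrow> pos_deg d p"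
  by (metis pos_deg_def le_antisym le_degree less_numeral_extra(3))

lemma pos_deg_mult: "pos_deg d p \<Longrightarrow> pos_deg e q \<Longrightarrow> pos_deg (d + e) (p * q)"
  unfolding pos_deg_def
  by (metis degree_mult_eq lead_coeff_mult leading_coeff_0_iff less_numeral_extra(3) mult_pos_pos)

lemma pos_deg_smult: "pos_deg d p \<Longrightarrow> c > 0 \<Longrightarrow> pos_deg d (smult c p)"
  by (auto simp: pos_deg_def)

lemma pos_deg_sum:
  assumes "finite A" "A \<noteq> {}" "\<And>a. a \<in> A \<Longrightarrow> pos_deg d (p a)"
  shows "pos_deg d (\<Sum>a\<in>A. p a)"
  using assms by (intro pos_degI) (auto simp: pos_deg_def coeff_sum intro!: degree_sum_le sum_pos)

lemma pos_deg_pcompose_linear: "pos_deg d p \<Longrightarrow> b > 0 \<Longrightarrow> pos_deg d (pcompose p [:a, b:])"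
  using lead_coeff_comp[of "[:a, b:]" p] by (auto simp: pos_deg_def degree_pcompose)

section \<open>Falling factorials and antidifferences\<close>

definition falling :: "nat \<Rightarrow> rat poly" where
  "falling d = (\<Prod>j<d. [:- of_nat j, 1:])"

lemma degree_falling: "degree (falling d) = d"
  unfolding falling_def by (subst degree_prod_eq_sum_degree) auto

lemma lead_coeff_falling: "lead_coeff (falling d) = 1"
  unfolding falling_def lead_coeff_prod by simp

lemma poly_falling: "poly (falling d) x = fact d * (x gchoose d)"
  by (simp add: falling_def poly_prod gbinomial_prod_rev atLeast0LessThan)

text \<open>Pascal's rule multiplied by \<open>fact (Suc d)\<close>: falling factorials play the
  role of powers for the difference operator.\<close>

lemma falling_diff: "poly (falling (Suc d)) (x + 1) - poly (falling (Suc d)) x = of_nat (Suc d) * poly (falling d) x"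
  unfolding poly_falling gbinomial_Suc_Suc by (simp add: algebra_simps)

text \<open>A multiple of a falling factorial removes the top coefficient and has an explicit
  antidifference; induction handles the rest. The top coefficient is recorded so that its sign can
  be tracked.\<close>

lemma antidifference:
  fixes q :: "rat poly"
  assumes "degree q \<le> d"
  shows "\<exists>Q. degree Q \<le> Suc d \<and> coeff Q (Suc d) = coeff q d / of_nat (Suc d)
    \<and> (\<forall>x. poly Q (x + 1) - poly Q x = poly q x)"
  using assms
proof (induction d arbitrary: q)
  case 0
  then obtain c where "q = [:c:]" by (metis degree_eq_zeroE le_zero_eq)
  then show ?case by (intro exI[of _ "[:0, c:]"]) (auto simp: algebra_simps)
next
  case (Suc d)
  define c where "c = coeff q (Suc d)"
  define r where "r = q - smult c (falling (Suc d))"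
  have fl: "coeff (falling e) e = 1" for e
    using lead_coeff_falling[of e] by (simp add: degree_falling)
  have "degree r \<le> Suc d"
    unfolding r_def using Suc.prems
    by (intro degree_diff_le order.trans[OF degree_smult_le]) (auto simp: degree_falling)
  moreover have "coeff r (Suc d) = 0"
    by (simp add: r_def c_def fl)
  ultimately have "degree r \<le> d"
    by (metis degree_0 eq_zero_or_degree_less le_0_eq le_SucE leading_coeff_0_iff zero_le)
  from Suc.IH[OF this] obtain Q where Q: "degree Q \<le> Suc d"
    "\<And>x. poly Q (x + 1) - poly Q x = poly r x" by blast
  let ?Q = "Q + smult (c / of_nat (Suc (Suc d))) (falling (Suc (Suc d)))"
  have "poly ?Q (x + 1) - poly ?Q x = poly q x" for x
  proof -
    have "poly ?Q (x + 1) - poly ?Q x = poly r x + c / of_nat (Suc (Suc d)) *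
       (poly (falling (Suc (Suc d))) (x + 1) - poly (falling (Suc (Suc d))) x)"
      using Q(2)[of x] by (simp add: algebra_simps)
    then show ?thesis
      unfolding falling_diff by (simp add: r_def del: of_nat_Suc)
  qed
  moreover have "coeff Q (Suc (Suc d)) = 0"
    using Q(1) by (intro coeff_eq_0) simp
  moreover have "degree ?Q \<le> Suc (Suc d)"
    using Q(1) by (intro degree_add_le order.trans[OF degree_smult_le]) (auto simp: degree_falling)
  ultimately show ?case
    by (intro exI[of _ ?Q]) (simp add: fl c_def del: of_nat_Suc)
qed

section \<open>Polynomial dependence on \<open>m\<close> and on \<open>n\<close>\<close>

lemma rising_coeff_Suc:
  "k \<le> m \<Longrightarrow> rising_coeff k (Suc r) (Suc m) = rising_coeff k (Suc r) m + of_nat (Suc m) * rising_coeff k r m"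
proof -
  assume "k \<le> m"
  then have "{k<..Suc m} = insert (Suc m) {k<..m}" by auto
  then show ?thesis by (simp add: rising_coeff_def del: of_nat_Suc)
qed

lemma rising_coeff_0: "rising_coeff k 0 m = 1"
  by (simp add: rising_coeff_def poly_prod flip: poly_0_coeff_0)

text \<open>By \<open>rising_coeff_Suc\<close>, the difference in \<open>m\<close> for degree
  \<open>r + 1\<close> is \<open>(m + 1) * E m\<close>, of degree \<open>2 * r + 1\<close>;
  summation raises the degree by one more and keeps the leading coefficient positive.\<close>

lemma rising_coeff_polynomial:
  "\<exists>Q. pos_deg (2 * r) Q \<and> (\<forall>m\<ge>k. rising_coeff k r m = poly Q (of_nat m))"
proof (induction r)
  case 0
  show ?case by (intro exI[of _ 1]) (auto simp: rising_coeff_0 pos_deg_def)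
next
  case (Suc r)
  then obtain E where E: "pos_deg (2 * r) E" "\<And>m. m \<ge> k \<Longrightarrow> rising_coeff k r m = poly E (of_nat m)"
    by blast
  have q: "pos_deg (Suc (2 * r)) ([:1, 1:] * E)"
  proof -
    have "pos_deg 1 [:1, 1:]" by (simp add: pos_deg_def)
    from pos_deg_mult[OF this E(1)] show ?thesis by (simp only: plus_1_eq_Suc)
  qed
  then obtain Q where Q: "degree Q \<le> Suc (Suc (2 * r))"
    "coeff Q (Suc (Suc (2 * r))) = coeff ([:1, 1:] * E) (Suc (2 * r)) / of_nat (Suc (Suc (2 * r)))"
    "\<And>x. poly Q (x + 1) - poly Q x = poly ([:1, 1:] * E) x"
    using antidifference[of "[:1, 1:] * E" "Suc (2 * r)"] by (auto simp: pos_deg_def)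
  \<comment> \<open>The constant is fixed by the value 0 at \<open>m = k\<close>, where the product
    is empty.\<close>
  let ?Q = "Q - [:poly Q (of_nat k):]"
  have "coeff ([:1, 1:] * E) (Suc (2 * r)) > 0"
    using q unfolding pos_deg_def by metis
  then have "coeff Q (Suc (Suc (2 * r))) > 0"
    unfolding Q(2) by (intro divide_pos_pos) simp_all
  then have "pos_deg (2 * Suc r) ?Q"
    using Q(1) by (intro pos_degI degree_diff_le) auto
  moreover have "rising_coeff k (Suc r) m = poly ?Q (of_nat m)" if "m \<ge> k" for m
    using that
  proof (induction m rule: dec_induct)
    case base
    show ?case by (simp add: rising_coeff_def)
  next
    case (step m)
    then show ?case
      using Q(3)[of "of_nat m"] E(2)[of m] rising_coeff_Suc[of k m r] by (simp add: algebra_simps)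
  qed
  ultimately show ?case by blast
qed

text \<open>The offset \<open>a\<close> treats both parities at once: \<open>- 1 / 2\<close> for odd
  and \<open>- 1\<close> for even \<open>n\<close>. Each summand has degree
  \<open>(2 * k + 1) + 2 * (i - k) = 2 * i + 1\<close>.\<close>

lemma acoef_polynomial:
  fixes a :: rat
  shows "\<exists>U. pos_deg (2 * i + 1) U \<and> (\<forall>n m. n \<le> 2 * m + 2 \<longrightarrow> of_nat m = of_nat n / 2 + a \<longrightarrow>
    (\<Sum>k\<le>i. of_nat (n choose (2 * k + 1)) * fact k * rising_coeff k (i - k) m) = poly U (of_nat n))"
proof -
  have "\<forall>k r. \<exists>Q. pos_deg (2 * r) Q \<and> (\<forall>m\<ge>k. rising_coeff k r m = poly Q (of_nat m))"
    using rising_coeff_polynomial by blast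
  then obtain Q where Q: "\<And>k r. pos_deg (2 * r) (Q k r)"
    "\<And>k r m. m \<ge> k \<Longrightarrow> rising_coeff k r m = poly (Q k r) (of_nat m)"
    unfolding choice_iff by blast
  define T where "T k = smult (fact k / fact (2 * k + 1))
    (falling (2 * k + 1) * pcompose (Q k (i - k)) [:a, 1 / 2:])" for k
  have "pos_deg (2 * i + 1) (T k)" if "k \<le> i" for k
  proof -
    have "pos_deg (2 * k + 1) (falling (2 * k + 1))"
      using lead_coeff_falling[of "2 * k + 1"] by (simp add: pos_deg_def degree_falling)
    then have "pos_deg (2 * k + 1 + 2 * (i - k)) (T k)"
      unfolding T_def by (intro pos_deg_smult pos_deg_mult pos_deg_pcompose_linear Q) auto
    moreover have "2 * k + 1 + 2 * (i - k) = 2 * i + 1"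
      using that by simp
    ultimately show ?thesis by metis
  qed
  then have "pos_deg (2 * i + 1) (\<Sum>k\<le>i. T k)"
    by (intro pos_deg_sum) auto
  moreover have "of_nat (n choose (2 * k + 1)) * fact k * rising_coeff k (i - k) m = poly (T k) (of_nat n)"
    if "n \<le> 2 * m + 2" and m: "of_nat m = of_nat n / 2 + a" for n m k
  proof -
    have T: "poly (T k) (of_nat n) = of_nat (n choose (2 * k + 1)) * fact k * poly (Q k (i - k)) (of_nat m)"
      unfolding T_def m
      by (simp add: poly_falling poly_pcompose binomial_gbinomial add.commute del: fact_Suc)
    show ?thesis
    proof (cases "k \<le> m")
      case True
      then show ?thesis by (simp add: T Q(2))
    next
      case False
      \<comment> \<open>For \<open>m < k\<close> the polynomial \<open>Q\<close> need not match
        \<open>rising_coeff\<close>, but the vanishing binomial hides this; here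
        \<open>n <= 2 * m + 2\<close> is needed.\<close>
      then have "n choose (2 * k + 1) = 0"
        using that by (intro binomial_eq_0) simp
      then show ?thesis by (simp only: T of_nat_0 mult_zero_left)
    qed
  qed
  ultimately show ?thesis
    by (intro exI[of _ "\<Sum>k\<le>i. T k"]) (simp add: poly_sum)
qed

section \<open>Explicit first coefficients and conclusion\<close>

lemma rising_coeff_1: "rising_coeff 0 1 m = of_nat m * (of_nat m + 1) / 2"
proof (induction m)
  case (Suc m)
  then show ?case
    using rising_coeff_Suc[of 0 m 0] by (simp add: rising_coeff_0 field_simps)
qed (simp add: rising_coeff_def)

lemma of_nat_choose_3: "of_nat (n choose 3) = (of_nat n * (of_nat n - 1) * (of_nat n - 2) / 6 :: rat)"
  by (simp add: binomial_gbinomial gbinomial_prod_rev numeral_3_eq_3 fact_numeral)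

theorem theorem6:
  shows "(\<forall>n\<ge>1. let m = (n - 1) div 2 in
            Pseq n = to_fract (\<Sum>i = 0..m. monom (acoef i n) (m - i)))
    \<and> (\<forall>n\<ge>1. acoef 0 n = (if odd n then of_nat n else of_nat n / 2))
    \<and> (\<forall>n\<ge>1. acoef 1 n =
          (if odd n then 1 / 24 * of_nat n * (of_nat n - 1) * (7 * of_nat n - 5)
           else 1 / 48 * of_nat n * (of_nat n - 2) * (7 * of_nat n - 4)))
    \<and> (\<forall>i. \<exists>U V :: rat poly. degree U = 2 * i + 1 \<and> degree V = 2 * i + 1
          \<and> (\<forall>n\<ge>1. odd n \<longrightarrow> acoef i n = poly U (of_nat n))
          \<and> (\<forall>n\<ge>2. even n \<longrightarrow> acoef i n = poly V (of_nat n)))"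
proof (intro conjI allI impI)
  fix n :: nat
  assume n: "n \<ge> 1"
  define m where "m = (n - 1) div 2"
  have "(\<Sum>i = 0..m. monom (acoef i n) (m - i)) = (\<Sum>i = 0..m. monom (coeff (Pclosed n) (m - i)) (m - i))"
    using n by (intro sum.cong) (simp_all add: acoef_def Ppoly_eq Let_def m_def)
  also have "\<dots> = (\<Sum>i\<le>m. monom (coeff (Pclosed n) i) i)"
    \<comment> \<open>Reversing the summation index turns descending into ascending powers.\<close>
    unfolding atLeast0AtMost[symmetric]
    by (subst sum.atLeastAtMost_rev) simp
  also have "\<dots> = Pclosed n"
    using degree_Pclosed[of n] by (intro poly_as_sum_of_monoms') (simp add: m_def)
  finally show "let m = (n - 1) div 2 in Pseq n = to_fract (\<Sum>i = 0..m. monom (acoef i n) (m - i))"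
    using Pseq_eq[OF n] by (simp only: Let_def m_def)
next
  fix n :: nat
  assume n: "n \<ge> 1"
  show "acoef 0 n = (if odd n then of_nat n else of_nat n / 2)"
    by (simp add: acoef_eq[OF n] rising_coeff_0)
next
  fix n :: nat
  assume n: "n \<ge> 1"
  define m where "m = (n - 1) div 2"
  have sum: "(\<Sum>k\<le>1. of_nat (n choose (2 * k + 1)) * fact k * rising_coeff k (1 - k) m)
      = of_nat n * rising_coeff 0 1 m + of_nat (n choose 3)"
    by (simp add: rising_coeff_0 numeral_3_eq_3)
  have a: "acoef 1 n = (if odd n then 1 else 1 / 2) * (of_nat n * (of_nat m * (of_nat m + 1) / 2)
      + of_nat n * (of_nat n - 1) * (of_nat n - 2) / 6)"
    unfolding acoef_eq[OF n] m_def[symmetric] sum rising_coeff_1 of_nat_choose_3 ..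
  have m: "n = (if odd n then 2 * m + 1 else 2 * m + 2)"
    using n unfolding m_def by presburger
  show "acoef 1 n = (if odd n then 1 / 24 * of_nat n * (of_nat n - 1) * (7 * of_nat n - 5)
           else 1 / 48 * of_nat n * (of_nat n - 2) * (7 * of_nat n - 4))"
  proof (cases "odd n")
    case True
    then have "(of_nat n :: rat) = 2 * of_nat m + 1" by (subst m) simp
    then have m': "of_nat m = (of_nat n - 1 :: rat) / 2" by simp
    show ?thesis using True unfolding a m' by (simp add: field_simps)
  next
    case False
    then have "(of_nat n :: rat) = 2 * of_nat m + 2" by (subst m) simp
    then have m': "of_nat m = (of_nat n - 2 :: rat) / 2" by simp
    show ?thesis using False unfolding a m' by (simp add: field_simps)
  qed
next
  fix i :: nat
  obtain U where U: "pos_deg (2 * i + 1) U"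
    "\<forall>n m. n \<le> 2 * m + 2 \<longrightarrow> of_nat m = of_nat n / 2 + (- 1 / 2 :: rat) \<longrightarrow>
    (\<Sum>k\<le>i. of_nat (n choose (2 * k + 1)) * fact k * rising_coeff k (i - k) m) = poly U (of_nat n)"
    using acoef_polynomial[of i "- 1 / 2"] by (elim exE conjE)
  obtain V where V: "pos_deg (2 * i + 1) V"
    "\<forall>n m. n \<le> 2 * m + 2 \<longrightarrow> of_nat m = of_nat n / 2 + (- 1 :: rat) \<longrightarrow>
    (\<Sum>k\<le>i. of_nat (n choose (2 * k + 1)) * fact k * rising_coeff k (i - k) m) = poly V (of_nat n)"
    using acoef_polynomial[of i "- 1"] by (elim exE conjE)
  have "acoef i n = poly U (of_nat n)" if n: "n \<ge> 1" "odd n" for n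
  proof -
    define m where "m = (n - 1) div 2"
    have m: "n = 2 * m + 1" using n unfolding m_def by presburger
    then have "n \<le> 2 * m + 2" "(of_nat m :: rat) = of_nat n / 2 + (- 1 / 2)" by simp_all
    from U(2)[rule_format, OF this] show ?thesis
      unfolding acoef_eq[OF n(1)] m_def[symmetric] using n(2) by (simp only: if_True simp_thms mult_1_left)
  qed
  \<comment> \<open>The factor \<open>1 / 2\<close> of the even case is absorbed into the
    polynomial.\<close>
  moreover have "acoef i n = poly (smult (1 / 2) V) (of_nat n)" if n: "n \<ge> 2" "even n" for n
  proof -
    define m where "m = (n - 1) div 2"
    have m: "n = 2 * m + 2" using n unfolding m_def by presburger
    then have "n \<le> 2 * m + 2" "(of_nat m :: rat) = of_nat n / 2 + (- 1)" by simp_all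
    from V(2)[rule_format, OF this] show ?thesis
      using acoef_eq[of n i] n unfolding m_def[symmetric] by (simp only: poly_smult if_False simp_thms)
  qed
  moreover have "degree (smult (1 / 2) V) = 2 * i + 1" "degree U = 2 * i + 1"
    using U(1) V(1) by (simp_all add: pos_deg_def)
  ultimately show "\<exists>U V :: rat poly. degree U = 2 * i + 1 \<and> degree V = 2 * i + 1
          \<and> (\<forall>n\<ge>1. odd n \<longrightarrow> acoef i n = poly U (of_nat n))
          \<and> (\<forall>n\<ge>2. even n \<longrightarrow> acoef i n = poly V (of_nat n))"
    by blast
qed

end
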